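(* Let $\Psi$ be a $k$-terminal reliability system (as in the context) satisfying $\mu_{\min}/\lambda_{\max}>m-1$ and having $N>1$ minimal cutsets. For every $\epsilon>0$ and $0<\delta<1$, the output $\tilde F_f$ of Algorithm A (described in the context) is an $(\epsilon,\delta)$-approximation of the steady-state failure frequency $F_f$, i.e. $\Pr\{|\tilde F_f-F_f|\ge \epsilon F_f\}\le\delta$.
   Context: System model. $\Psi$ is an undirected graph with $n$ nodes, $k$ of which ($2\le k\le n$) are called terminals, and $m$ edges called components, indexed by $[m]=\{1,\dots,m\}$. Each component $i$ alternates between "available" (up) and "unavailable" (down); its up-times have mean $1/\lambda_i$ and its down-times have mean $1/\mu_i$ ($\lambda_i,\mu_i>0$ constants, the failure and repair rates), with arbitrary distributions; these stationary processes are statistically independent across components. In steady state component $i$ is unavailable with probability $p_i=\lambda_i/(\lambda_i+\mu_i)\in(0,1)$, independently of the other components; its weight is $w_i=-\log p_i$ (natural log). At any time the system is unavailable (failed) if the subgraph formed by all nodes and the available components does not connect all $k$ terminals. $P_f$ is the steady-state probability that the system is unavailable and $F_f$ is the steady-state failure frequency, i.e. the expected number of transitions of the system into the unavailable state per unit time. (Equivalently, writing a system state as the set $\mathcal I$ of unavailable components, with probability $p(\mathcal I)=\prod_{i\in\mathcal I}p_i\prod_{i\notin\mathcal I}(1-p_i)$, and $\mathcal S_f$ for the failed states, $P_f=\sum_{\mathcal I\in\mathcal S_f}p(\mathcal I)$ and $F_f=\sum_{\mathcal I\in\mathcal S_f}p(\mathcal I)\big(\sum_{i\in\mathcal I}\mu_i-\sum_{i\notin\mathcal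 I}\lambda_i\big)$.) Cutsets. A cutset is a set of components whose simultaneous unavailability makes the system unavailable and which is minimal with this property; $\mathcal C_1,\dots,\mathcal C_N$ are all the (minimal) cutsets. For a set $\mathcal C$ of components, $p(\mathcal C)=\prod_{i\in\mathcal C}p_i$. Let $s^*=\min_j|\mathcal C_j|$, $\lambda_{\max}=\max_i\lambda_i$, $\mu_{\min}=\min_i\mu_i$, $\mu=\sum_{i=1}^m\mu_i$. $(\xi,\delta)$-approximation: a random quantity $\tilde X$ is a $(\xi,\delta)$-approximation of $X>0$ if $\Pr\{|\tilde X-X|\ge\xi X\}\le\delta$. KLM estimator with inputs $(Z_1,\dots,Z_M;\,P_Z;\,\xi,\delta)$: here $Z_1,\dots,Z_M$ are events (clauses) defined in terms of a random assignment $\boldsymbol z$, and $P_Z(j)=\Pr\{Z_j\text{ holds}\}$. Let $Q_Z=\sum_jP_Z(j)$, $S=\lceil4(M-1)/\xi^2\rceil$, $T=\lceil12\log(1/\delta)\rceil$. For each $t=1,\dots,T$ and $s=1,\dots,S$ (all randomness independent): choose $j$ with probability $P_Z(j)/Q_Z$; draw an assignment $\boldsymbol z$ from the distribution of the random assignment conditioned on $Z_j$ holding; set $\pi_{s,t}=Q_Z/N(\boldsymbol z)$, where $N(\boldsymbol z)$ is the number of clauses that $\boldsymbol z$ satisfies. Let $\pi_t=\frac1S\sum_s\pi_{s,t}$; output the median of $\pi_1,\dots,\pi_T$. Random assignment used below: Boolean variables $x_1,\dots,x_m$ independent with $x_i$ true with probability $p_i$ ("sampling"); independently, one index $I\in[m]$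 is chosen with $\Pr\{I=i\}=\mu_i/\mu$, and $y_I$ is false while $y_i$ is true for all $i\ne I$ ("exposure": component $I$ is exposed, others unexposed). For each cutset $\mathcal C_j$: $X_j=\bigwedge_{i\in\mathcal C_j}x_i$, $Y_j=\bigwedge_{i\in\mathcal C_j}y_i$, $Z_j=X_j\wedge Y_j$; $P_X(j)=p(\mathcal C_j)$ and $P_Z(j)=p(\mathcal C_j)\big(1-\sum_{i\in\mathcal C_j}\mu_i/\mu\big)$. Algorithm A (inputs $\{\lambda_i\},\{\mu_i\},\epsilon>0,0<\delta<1$): (0) enumerate all $N$ cutsets; compute $s^*,\mu_{\min},\lambda_{\max},\mu$, $\rho=\mu_{\min}s^*-\lambda_{\max}(m-s^* )$ and $\xi=(\epsilon/2)(\rho/\mu)$. (1) Let $\tilde P$ be the output of the KLM estimator with inputs $(Z_1,\dots,Z_N;P_Z;\xi,\delta/2)$. (2) Let $\tilde P_f$ be the output of an independent run of the KLM estimator with inputs $(X_1,\dots,X_N;P_X;\xi,\delta/2)$. (3) Return $\tilde F_f=(\tilde P_f-\tilde P)\mu$. *)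

theory Defs
  imports "HOL-Probability.Probability"
begin

section \<open>k-terminal reliability systems\<close>

text \<open>Components are indexed, so parallel edges are permitted; \<open>ends \<Psi> i\<close> is the set of end nodes of
  component \<open>i\<close> (a singleton for a loop). Only indices in \<open>{1..ncomps \<Psi>}\<close> are meaningful.\<close>

record 'v rel_system =
  nodes :: "'v set"
  terminals :: "'v set"
  ncomps :: nat
  ends :: "nat \<Rightarrow> 'v set"
  fail_rate :: "nat \<Rightarrow> real"
  repair_rate :: "nat \<Rightarrow> real"

definition comps :: "'v rel_system \<Rightarrow> nat set" where
  "comps \<Psi> = {1..ncomps \<Psi>}"

definition k_terminal_system :: "'v rel_system \<Rightarrow> bool" where
  "k_terminal_system \<Psi> \<longleftrightarrow>
     finite (nodes \<Psi>) \<and> terminals \<Psi> \<subseteq> nodes \<Psi> \<and> 2 \<le> card (terminals \<Psi>) \<and>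
     (\<forall>i\<in>comps \<Psi>. ends \<Psi> i \<subseteq> nodes \<Psi> \<and> card (ends \<Psi> i) \<in> {1, 2}) \<and>
     (\<forall>i\<in>comps \<Psi>. 0 < fail_rate \<Psi> i \<and> 0 < repair_rate \<Psi> i)"

definition adjacency :: "'v rel_system \<Rightarrow> nat set \<Rightarrow> ('v \<times> 'v) set" where
  "adjacency \<Psi> A = {(u, v). \<exists>i\<in>A. ends \<Psi> i = {u, v}}"

definition connects_terminals :: "'v rel_system \<Rightarrow> nat set \<Rightarrow> bool" where
  "connects_terminals \<Psi> A \<longleftrightarrow>
     (\<forall>s\<in>terminals \<Psi>. \<forall>t\<in>terminals \<Psi>. (s, t) \<in> (adjacency \<Psi> A)\<^sup>*)"

text \<open>A system state is represented by its set of unavailable components.\<close>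

definition failed_states :: "'v rel_system \<Rightarrow> nat set set" where
  "failed_states \<Psi> = {D. D \<subseteq> comps \<Psi> \<and> \<not> connects_terminals \<Psi> (comps \<Psi> - D)}"

definition cutsets :: "'v rel_system \<Rightarrow> nat set set" where
  "cutsets \<Psi> = {C \<in> failed_states \<Psi>. \<forall>D. D \<subset> C \<longrightarrow> D \<notin> failed_states \<Psi>}"

definition unavail :: "'v rel_system \<Rightarrow> nat \<Rightarrow> real" where
  "unavail \<Psi> i = fail_rate \<Psi> i / (fail_rate \<Psi> i + repair_rate \<Psi> i)"

definition state_prob :: "'v rel_system \<Rightarrow> nat set \<Rightarrow> real" where
  "state_prob \<Psi> D = (\<Prod>i\<in>D. unavail \<Psi> i) * (\<Prod>i\<in>comps \<Psi> - D. 1 - unavail \<Psi> i)"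

text \<open>The steady-state failure frequency. In steady state the system leaves state \<open>D\<close> by repairs at rate
  \<open>\<Sum>i\<in>D. \<mu>\<^sub>i\<close> and by further failures at rate \<open>\<Sum>i\<notin>D. \<lambda>\<^sub>i\<close>. By the balance
  \<open>p(D) \<mu>\<^sub>i = p(D - {i}) \<lambda>\<^sub>i\<close> for \<open>i \<in> D\<close>, transitions between failed states cancel in the sum below, which
  leaves the rate of transitions between the failed and the working states.\<close>

definition failure_frequency :: "'v rel_system \<Rightarrow> real" where
  "failure_frequency \<Psi> =
     (\<Sum>D\<in>failed_states \<Psi>. state_prob \<Psi> D *
        ((\<Sum>i\<in>D. repair_rate \<Psi> i) - (\<Sum>i\<in>comps \<Psi> - D. fail_rate \<Psi> i)))"

definition min_cut_size :: "'v rel_system \<Rightarrow> nat" where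
  "min_cut_size \<Psi> = Min (card ` cutsets \<Psi>)"

definition fail_max :: "'v rel_system \<Rightarrow> real" where
  "fail_max \<Psi> = Max (fail_rate \<Psi> ` comps \<Psi>)"

definition repair_min :: "'v rel_system \<Rightarrow> real" where
  "repair_min \<Psi> = Min (repair_rate \<Psi> ` comps \<Psi>)"

definition repair_total :: "'v rel_system \<Rightarrow> real" where
  "repair_total \<Psi> = (\<Sum>i\<in>comps \<Psi>. repair_rate \<Psi> i)"


section \<open>The KLM estimator\<close>

definition is_approximation :: "real \<Rightarrow> real \<Rightarrow> real pmf \<Rightarrow> real \<Rightarrow> bool" where
  "is_approximation \<xi> \<delta> X' X \<longleftrightarrow> measure_pmf.prob X' {x. \<bar>x - X\<bar> \<ge> \<xi> * X} \<le> \<delta>"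

definition median :: "real list \<Rightarrow> real" where
  "median xs = (let ys = sort xs; n = length xs in
     if odd n then ys ! (n div 2) else (ys ! (n div 2 - 1) + ys ! (n div 2)) / 2)"

text \<open>The distribution on \<open>A\<close> with probabilities proportional to \<open>w\<close>, for finite \<open>A\<close>, nonnegative \<open>w\<close> and
  positive total weight.\<close>

definition weighted_pmf :: "'a set \<Rightarrow> ('a \<Rightarrow> real) \<Rightarrow> 'a pmf" where
  "weighted_pmf A w = embed_pmf (\<lambda>a. if a \<in> A then w a / (\<Sum>b\<in>A. w b) else 0)"

text \<open>\<open>A\<close> is the distribution of the random assignment; the clauses are events \<open>Z j\<close> indexed by a finite
  set \<open>J\<close>.\<close>

definition klm_trial :: "'z pmf \<Rightarrow> 'j set \<Rightarrow> ('j \<Rightarrow> 'z set) \<Rightarrow> ('j \<Rightarrow> real) \<Rightarrow> real pmf" where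
  "klm_trial A J Z P = do {
     j \<leftarrow> weighted_pmf J P;
     z \<leftarrow> cond_pmf A (Z j);
     return_pmf ((\<Sum>i\<in>J. P i) / real (card {i\<in>J. z \<in> Z i}))
   }"

definition klm_estimator ::
  "'z pmf \<Rightarrow> 'j set \<Rightarrow> ('j \<Rightarrow> 'z set) \<Rightarrow> ('j \<Rightarrow> real) \<Rightarrow> real \<Rightarrow> real \<Rightarrow> real pmf" where
  "klm_estimator A J Z P \<xi> \<delta> =
     (let S = nat \<lceil>4 * (real (card J) - 1) / \<xi>\<^sup>2\<rceil>;
          T = nat \<lceil>12 * ln (1 / \<delta>)\<rceil>
      in map_pmf
           (\<lambda>\<pi>. median (map (\<lambda>t. (\<Sum>s\<in>{1..S}. \<pi> (s, t)) / real S) [1..<Suc T]))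
           (Pi_pmf ({1..S} \<times> {1..T}) 0 (\<lambda>_. klm_trial A J Z P)))"


section \<open>The algorithm\<close>

text \<open>The pair \<open>(x, y)\<close> consists of the sampling variables \<open>x\<close> and the exposure variables \<open>y\<close>.\<close>

definition assignment :: "'v rel_system \<Rightarrow> ((nat \<Rightarrow> bool) \<times> (nat \<Rightarrow> bool)) pmf" where
  "assignment \<Psi> = do {
     x \<leftarrow> Pi_pmf (comps \<Psi>) False (\<lambda>i. bernoulli_pmf (unavail \<Psi> i));
     e \<leftarrow> weighted_pmf (comps \<Psi>) (repair_rate \<Psi>);
     return_pmf (x, \<lambda>i. i \<noteq> e)
   }"

definition clause_X :: "nat set \<Rightarrow> ((nat \<Rightarrow> bool) \<times> (nat \<Rightarrow> bool)) set" where
  "clause_X C = {(x, y). \<forall>i\<in>C. x i}"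

definition clause_Y :: "nat set \<Rightarrow> ((nat \<Rightarrow> bool) \<times> (nat \<Rightarrow> bool)) set" where
  "clause_Y C = {(x, y). \<forall>i\<in>C. y i}"

definition clause_Z :: "nat set \<Rightarrow> ((nat \<Rightarrow> bool) \<times> (nat \<Rightarrow> bool)) set" where
  "clause_Z C = clause_X C \<inter> clause_Y C"

definition prob_X :: "'v rel_system \<Rightarrow> nat set \<Rightarrow> real" where
  "prob_X \<Psi> C = (\<Prod>i\<in>C. unavail \<Psi> i)"

definition prob_Z :: "'v rel_system \<Rightarrow> nat set \<Rightarrow> real" where
  "prob_Z \<Psi> C = prob_X \<Psi> C * (1 - (\<Sum>i\<in>C. repair_rate \<Psi> i / repair_total \<Psi>))"

definition rho :: "'v rel_system \<Rightarrow> real" where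
  "rho \<Psi> = repair_min \<Psi> * real (min_cut_size \<Psi>)
            - fail_max \<Psi> * (real (ncomps \<Psi>) - real (min_cut_size \<Psi>))"

definition algorithm_A :: "'v rel_system \<Rightarrow> real \<Rightarrow> real \<Rightarrow> real pmf" where
  "algorithm_A \<Psi> \<epsilon> \<delta> = (let \<xi> = (\<epsilon> / 2) * (rho \<Psi> / repair_total \<Psi>) in do {
     P \<leftarrow> klm_estimator (assignment \<Psi>) (cutsets \<Psi>) clause_Z (prob_Z \<Psi>) \<xi> (\<delta> / 2);
     P\<^sub>f \<leftarrow> klm_estimator (assignment \<Psi>) (cutsets \<Psi>) clause_X (prob_X \<Psi>) \<xi> (\<delta> / 2);
     return_pmf ((P\<^sub>f - P) * repair_total \<Psi>)
   })"

end

theory Submission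
  imports Defs
begin

text \<open>
  Let \<open>P\<^sub>f\<close> and \<open>P\<close> be the probabilities of the unions of the clauses \<open>X\<^sub>j\<close> and \<open>Z\<^sub>j\<close>. For sampled state \<open>D\<close>
  and exposed component \<open>e\<close>, some \<open>X\<^sub>j\<close> holds iff \<open>D\<close> is failed, and some \<open>Z\<^sub>j\<close> holds iff \<open>D - {e}\<close> is
  failed. Hence \<open>(P\<^sub>f - P) \<mu>\<close> is the sum of \<open>p(D) \<mu>\<^sub>i\<close> over failed \<open>D\<close> and \<open>i \<in> D\<close> whose repair restores the
  system; by the balance \<open>p(D) \<mu>\<^sub>i = p(D - {i}) \<lambda>\<^sub>i\<close> this equals \<open>F\<^sub>f\<close>. Every failed state contains at least
  \<open>s\<^sup>*\<close> components, so \<open>F\<^sub>f \<ge> \<rho> P\<^sub>f\<close>, and relative errors below \<open>\<xi>\<close> in \<open>P\<^sub>f\<close> and in \<open>P \<le> P\<^sub>f\<close> amount to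
  an error below \<open>2 \<xi> \<mu> P\<^sub>f = \<epsilon> \<rho> P\<^sub>f \<le> \<epsilon> F\<^sub>f\<close>.

  One trial of the estimator has mean \<open>p\<close>, the probability of the union, and values in \<open>[0, Q]\<close> with
  \<open>Q \<le> M p\<close>, so its variance is at most \<open>(M - 1) p\<^sup>2\<close>. By Chebyshev each of the \<open>T\<close> averages is off by
  \<open>\<xi> p\<close> with probability at most \<open>1/4\<close>. If the median is off, at least half of the averages are, which has
  probability at most \<open>exp (- T / 8)\<close> by Hoeffding.
\<close>

section \<open>The KLM estimator\<close>

text \<open>After centring, independence makes every off-diagonal product have expectation zero, so
  expanding the square leaves only the diagonal. This feeds the Chebyshev bound for one
  average.\<close>

lemma (in prob_space) variance_sum_indep:
  fixes X :: "'i \<Rightarrow> 'a \<Rightarrow> real"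
  assumes fin: "finite I" and ind: "indep_vars (\<lambda>_. borel) X I"
    and sq: "\<And>i. i \<in> I \<Longrightarrow> integrable M (\<lambda>x. (X i x)\<^sup>2)"
  shows "variance (\<lambda>x. \<Sum>i\<in>I. X i x) = (\<Sum>i\<in>I. variance (X i))"
proof -
  have rv: "X i \<in> borel_measurable M" if "i \<in> I" for i
    using ind that by (auto simp: indep_vars_def)
  have intX: "integrable M (X i)" if "i \<in> I" for i
    using square_integrable_imp_integrable[OF rv[OF that] sq[OF that]] .
  define Y where "Y = (\<lambda>i x. X i x - expectation (X i))"
  have indY: "indep_vars (\<lambda>_. borel) Y I"
    unfolding Y_def by (rule indep_vars_compose2[OF ind]) simp
  have intY: "integrable M (Y i)" if "i \<in> I" for i
    using intX[OF that] by (simp add: Y_def)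
  have Y0: "expectation (Y i) = 0" if "i \<in> I" for i
    using intX[OF that] by (simp add: Y_def prob_space)
  have sqY: "integrable M (\<lambda>x. Y i x * Y i x)" if "i \<in> I" for i
    using sq[OF that] intX[OF that]
    by (simp add: Y_def algebra_simps power2_eq_square)
  have pair: "integrable M (\<lambda>x. Y i x * Y j x) \<and> expectation (\<lambda>x. Y i x * Y j x) = 0"
    if "i \<in> I" "j \<in> I" "i \<noteq> j" for i j
  proof -
    have ind2: "indep_vars (\<lambda>_. borel) Y {i, j}"
      by (rule indep_vars_subset[OF indY]) (use that in auto)
    have int2: "\<And>k. k \<in> {i, j} \<Longrightarrow> integrable M (Y k)"
      using that intY by auto
    show ?thesis
      using indep_vars_integrable[OF _ ind2 int2] indep_vars_lebesgue_integral[OF _ ind2 int2]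
        that Y0 by simp
  qed
  have int: "integrable M (\<lambda>x. Y i x * Y j x)" if "i \<in> I" "j \<in> I" for i j
    using pair[OF that] sqY[of i] that by (cases "i = j") auto
  have "variance (\<lambda>x. \<Sum>i\<in>I. X i x) = expectation (\<lambda>x. (\<Sum>i\<in>I. Y i x)\<^sup>2)"
    using intX by (simp add: Y_def sum_subtractf)
  also have "\<dots> = expectation (\<lambda>x. \<Sum>i\<in>I. \<Sum>j\<in>I. Y i x * Y j x)"
    by (simp add: power2_eq_square sum_product)
  also have "\<dots> = (\<Sum>i\<in>I. \<Sum>j\<in>I. expectation (\<lambda>x. Y i x * Y j x))"
    using int by simp
  also have "\<dots> = (\<Sum>i\<in>I. \<Sum>j\<in>I. if j = i then expectation (\<lambda>x. Y i x * Y i x) else 0)"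
    using pair by (intro sum.cong) auto
  also have "\<dots> = (\<Sum>i\<in>I. variance (X i))"
    using fin by (simp add: Y_def power2_eq_square)
  finally show ?thesis .
qed

section \<open>One trial of the estimator: mean and variance\<close>

lemma pmf_weighted_pmf:
  assumes fin: "finite A" and nonneg: "\<And>a. a \<in> A \<Longrightarrow> 0 \<le> w a" and pos: "0 < (\<Sum>a\<in>A. w a)"
  shows "pmf (weighted_pmf A w) a = (if a \<in> A then w a / (\<Sum>b\<in>A. w b) else 0)"
  unfolding weighted_pmf_def
proof (rule pmf_embed_pmf)
  show "0 \<le> (if x \<in> A then w x / (\<Sum>b\<in>A. w b) else 0)" for x
    using nonneg pos by auto
  have "(\<integral>\<^sup>+x. ennreal (if x \<in> A then w x / (\<Sum>b\<in>A. w b) else 0) \<partial>count_space UNIV)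
      = (\<Sum>x\<in>A. ennreal (w x / (\<Sum>b\<in>A. w b)))"
    by (subst nn_integral_count_space'[of A]) (use fin in auto)
  also have "\<dots> = ennreal (\<Sum>x\<in>A. w x / (\<Sum>b\<in>A. w b))"
    using nonneg pos by (intro sum_ennreal) auto
  also have "\<dots> = 1"
    using pos by (simp flip: sum_divide_distrib)
  finally show "(\<integral>\<^sup>+x. ennreal (if x \<in> A then w x / (\<Sum>b\<in>A. w b) else 0) \<partial>count_space UNIV) = 1" .
qed

text \<open>Supplies the side condition under which \<open>cond_pmf A Z\<close> is a genuine
  conditional distribution.\<close>

lemma measure_pmf_pos_imp_Int_set_pmf:
  assumes "0 < measure_pmf.prob A Z"
  shows "set_pmf A \<inter> Z \<noteq> {}"
proof
  assume "set_pmf A \<inter> Z = {}"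
  then have "measure_pmf.prob A Z = 0"
    by (subst measure_pmf_zero_iff) auto
  with assms show False by simp
qed

text \<open>The sum of weights is divided by a count that is at least 1 or, formally, 0. The bounds
  give integrability and the second-moment estimate.\<close>

lemma klm_trial_bounds:
  assumes fin: "finite J" and nonneg: "\<And>j. j \<in> J \<Longrightarrow> 0 \<le> P j"
    and r: "r \<in> set_pmf (klm_trial A J Z P)"
  shows "0 \<le> r" "r \<le> (\<Sum>j\<in>J. P j)"
proof -
  obtain z where z: "r = (\<Sum>i\<in>J. P i) / real (card {i\<in>J. z \<in> Z i})"
    using r by (auto simp: klm_trial_def)
  have Q: "0 \<le> (\<Sum>j\<in>J. P j)" using nonneg by (rule sum_nonneg)
  show "0 \<le> r" using Q by (simp add: z)
  show "r \<le> (\<Sum>j\<in>J. P j)"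
  \<comment> \<open>If \<open>z\<close> satisfies no clause, the convention for division by zero
    makes the trial value 0.\<close>
  proof (cases "card {i\<in>J. z \<in> Z i} = 0")
    case True
    show ?thesis using Q by (simp only: z True) simp
  next
    case False
    then have "1 \<le> real (card {i\<in>J. z \<in> Z i})" by linarith
    then have "(\<Sum>j\<in>J. P j) * 1 \<le> (\<Sum>j\<in>J. P j) * real (card {i\<in>J. z \<in> Z i})"
      using Q by (rule mult_left_mono)
    then show ?thesis using False by (simp add: z divide_le_eq)
  qed
qed

text \<open>Importance sampling: \<open>z\<close> is drawn with probability proportional to
  \<open>pmf A z\<close> times the number of clauses it satisfies, and the trial value divides that
  multiplicity out again, so each point of the union counts once.\<close>

lemma expectation_klm_trial:
  assumes fin: "finite J" and ne: "J \<noteq> {}"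
    and P: "\<And>j. j \<in> J \<Longrightarrow> P j = measure_pmf.prob A (Z j)"
    and pos: "\<And>j. j \<in> J \<Longrightarrow> 0 < P j"
  shows "measure_pmf.expectation (klm_trial A J Z P) (\<lambda>r. r) = measure_pmf.prob A (\<Union>j\<in>J. Z j)"
proof -
  define Q where "Q = (\<Sum>j\<in>J. P j)"
  define N where "N = (\<lambda>z. card {i\<in>J. z \<in> Z i})"
  define B where "B = weighted_pmf J P \<bind> (\<lambda>j. cond_pmf A (Z j))"
  have Qpos: "0 < Q" unfolding Q_def using fin ne pos by (rule sum_pos)
  note pw = pmf_weighted_pmf[OF fin, of P, folded Q_def, OF less_imp_le[OF pos] Qpos]
  have ne_cond: "set_pmf A \<inter> Z j \<noteq> {}" if "j \<in> J" for j
    using pos[OF that] P[OF that] by (intro measure_pmf_pos_imp_Int_set_pmf) simp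
  \<comment> \<open>The weight \<open>P j\<close> of choosing \<open>j\<close> cancels the
    normalising constant of conditioning on \<open>Z j\<close>, so each satisfied clause contributes
    \<open>pmf A z / Q\<close>.\<close>
  have pmfB: "pmf B z = pmf A z * real (N z) / Q" for z
  proof -
    have "pmf B z = (\<Sum>j\<in>J. pmf (cond_pmf A (Z j)) z * pmf (weighted_pmf J P) j)"
      unfolding B_def pmf_bind
      by (rule integral_measure_pmf_real[OF fin]) (auto simp: set_pmf_iff pw split: if_splits)
    also have "\<dots> = (\<Sum>j\<in>J. if z \<in> Z j then pmf A z / Q else 0)"
    proof (rule sum.cong[OF refl])
      fix j assume j: "j \<in> J"
      show "pmf (cond_pmf A (Z j)) z * pmf (weighted_pmf J P) j = (if z \<in> Z j then pmf A z / Q else 0)"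
        using j pos[OF j] by (simp add: pmf_cond[OF ne_cond[OF j]] pw P[symmetric])
    qed
    also have "\<dots> = pmf A z * real (N z) / Q"
      using fin by (simp add: sum.If_cases N_def Int_def)
    finally show ?thesis .
  qed
  have tr: "klm_trial A J Z P = map_pmf (\<lambda>z. Q / real (N z)) B"
    by (simp add: klm_trial_def B_def Q_def N_def map_pmf_def bind_assoc_pmf)
  have "measure_pmf.expectation (klm_trial A J Z P) (\<lambda>r. r)
      = measure_pmf.expectation B (\<lambda>z. Q / real (N z))"
    by (simp add: tr)
  \<comment> \<open>Over counting measure the two expectations can be compared pointwise.\<close>
  also have "\<dots> = (\<integral>z. pmf B z * (Q / real (N z)) \<partial>count_space UNIV)"
    unfolding measure_pmf_eq_density by (subst integral_density) auto
  also have "\<dots> = (\<integral>z. pmf A z * indicator (\<Union>j\<in>J. Z j) z \<partial>count_space UNIV)"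
  proof (rule Bochner_Integration.integral_cong[OF refl])
    fix z
    have "N z = 0 \<longleftrightarrow> z \<notin> (\<Union>j\<in>J. Z j)"
      using fin by (auto simp: N_def)
    then show "pmf B z * (Q / real (N z)) = pmf A z * indicator (\<Union>j\<in>J. Z j) z"
      using Qpos by (cases "N z = 0") (auto simp: pmfB)
  qed
  also have "\<dots> = measure_pmf.expectation A (indicator (\<Union>j\<in>J. Z j))"
    unfolding measure_pmf_eq_density by (subst integral_density) auto
  finally show ?thesis by simp
qed

text \<open>Pointwise \<open>r\<^sup>2 \<le> Q * r\<close>, and every \<open>P j\<close> is at most
  \<open>p\<close>; hence the second moment is at most \<open>card J * p\<^sup>2\<close>.
  Subtracting the squared mean turns \<open>card J\<close> into \<open>card J - 1\<close>, the
  factor in the sample size \<open>S\<close>.\<close>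

lemma variance_klm_trial_le:
  assumes fin: "finite J" and ne: "J \<noteq> {}"
    and P: "\<And>j. j \<in> J \<Longrightarrow> P j = measure_pmf.prob A (Z j)"
    and pos: "\<And>j. j \<in> J \<Longrightarrow> 0 < P j"
  defines "p \<equiv> measure_pmf.prob A (\<Union>j\<in>J. Z j)"
  shows "measure_pmf.variance (klm_trial A J Z P) (\<lambda>r. r) \<le> (real (card J) - 1) * p\<^sup>2"
proof -
  let ?K = "klm_trial A J Z P" and ?Q = "\<Sum>j\<in>J. P j"
  have bounds: "0 \<le> r" "r \<le> (\<Sum>j\<in>J. P j)" if "r \<in> set_pmf ?K" for r
    using klm_trial_bounds[OF fin less_imp_le that] pos by auto
  have E: "measure_pmf.expectation ?K (\<lambda>r. r) = p"
    unfolding p_def by (rule expectation_klm_trial[OF fin ne P pos])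
  have AE_b: "AE r in ?K. 0 \<le> r \<and> r \<le> ?Q"
    using bounds by (auto simp: AE_measure_pmf_iff)
  have int1: "integrable ?K (\<lambda>r. r)"
    by (rule measure_pmf.integrable_const_bound[where B = ?Q]) (use AE_b in auto)
  have sq: "0 \<le> r\<^sup>2 \<and> r\<^sup>2 \<le> ?Q * r" if "r \<in> set_pmf ?K" for r
    using bounds[OF that] by (auto simp: power2_eq_square intro: mult_right_mono)
  have int2: "integrable ?K (\<lambda>r. r\<^sup>2)"
  proof (rule measure_pmf.integrable_const_bound[where B = "?Q\<^sup>2"])
    show "AE r in ?K. norm (r\<^sup>2) \<le> ?Q\<^sup>2"
      using bounds by (auto simp: AE_measure_pmf_iff intro: power_mono)
  qed simp
  have "measure_pmf.expectation ?K (\<lambda>r. r\<^sup>2) \<le> measure_pmf.expectation ?K (\<lambda>r. ?Q * r)"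
    using sq int1 int2 by (intro integral_mono_AE) (auto simp: AE_measure_pmf_iff)
  also have "\<dots> = ?Q * p" by (simp add: E)
  also have "\<dots> \<le> (real (card J) * p) * p"
  proof (rule mult_right_mono)
    show "?Q \<le> real (card J) * p"
    proof (rule sum_bounded_above)
      fix j assume "j \<in> J"
      then show "P j \<le> p"
        unfolding p_def using P by (auto intro!: measure_pmf.finite_measure_mono)
    qed
  qed (simp add: p_def)
  finally have "measure_pmf.expectation ?K (\<lambda>r. r\<^sup>2) \<le> real (card J) * p\<^sup>2"
    by (simp add: power2_eq_square)
  then show ?thesis
    by (subst measure_pmf.variance_eq[OF int1 int2]) (simp add: E algebra_simps)
qed

section \<open>Median of means\<close>

text \<open>In sorted order, a median that is too large forces the whole upper half to be too large,
  and one that is too small forces the whole lower half to be too small.\<close>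

lemma median_deviation:
  assumes ne: "xs \<noteq> []" and dev: "d \<le> \<bar>median xs - c\<bar>"
  shows "length xs \<le> 2 * length (filter (\<lambda>x. d \<le> \<bar>x - c\<bar>) xs)"
proof -
  define ys where "ys = sort xs"
  define n where "n = length xs"
  have n: "0 < n" "length ys = n" using ne by (auto simp: n_def ys_def)
  have mono: "ys ! i \<le> ys ! j" if "i \<le> j" "j < n" for i j
    using that n by (intro sorted_nth_mono) (auto simp: ys_def)
  have med: "median xs = (if odd n then ys ! (n div 2) else (ys ! (n div 2 - 1) + ys ! (n div 2)) / 2)"
    by (simp add: median_def Let_def ys_def n_def)
  have "mset (filter (\<lambda>x. d \<le> \<bar>x - c\<bar>) xs) = mset (filter (\<lambda>x. d \<le> \<bar>x - c\<bar>) ys)"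
    by (simp add: ys_def)
  then have "length (filter (\<lambda>x. d \<le> \<bar>x - c\<bar>) xs) = length (filter (\<lambda>x. d \<le> \<bar>x - c\<bar>) ys)"
    by (metis size_mset)
  also have "\<dots> = card {i. i < n \<and> d \<le> \<bar>ys ! i - c\<bar>}"
    by (simp add: length_filter_conv_card n)
  finally have len: "length (filter (\<lambda>x. d \<le> \<bar>x - c\<bar>) xs) = card {i. i < n \<and> d \<le> \<bar>ys ! i - c\<bar>}" .
  \<comment> \<open>\<open>k\<close> is the lower middle position and \<open>n div 2\<close> the
    upper one; they coincide for odd \<open>n\<close>, and the median lies between their entries for
    either parity.\<close>
  define k where "k = (if odd n then n div 2 else n div 2 - 1)"
  have k: "k \<le> n div 2" "n div 2 < n" "n \<le> 2 * (k + 1)"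
    using n by (auto simp: k_def elim!: evenE oddE)
  have mid: "ys ! k \<le> ys ! (n div 2)" using mono k by blast
  have between: "ys ! k \<le> median xs" "median xs \<le> ys ! (n div 2)"
    using mid by (auto simp: med k_def)
  consider "d \<le> median xs - c" | "d \<le> c - median xs" using dev by linarith
  then have "n \<le> 2 * card {i. i < n \<and> d \<le> \<bar>ys ! i - c\<bar>}"
  proof cases
    case 1
    have "{n div 2..<n} \<subseteq> {i. i < n \<and> d \<le> \<bar>ys ! i - c\<bar>}"
    proof
      fix i assume i: "i \<in> {n div 2..<n}"
      then have "ys ! (n div 2) \<le> ys ! i" by (intro mono) auto
      then show "i \<in> {i. i < n \<and> d \<le> \<bar>ys ! i - c\<bar>}" using i 1 between by auto
    qed
    then have "card {n div 2..<n} \<le> card {i. i < n \<and> d \<le> \<bar>ys ! i - c\<bar>}"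
      by (intro card_mono) auto
    then show ?thesis by simp
  next
    case 2
    have "{..k} \<subseteq> {i. i < n \<and> d \<le> \<bar>ys ! i - c\<bar>}"
    proof
      fix i assume i: "i \<in> {..k}"
      then have "ys ! i \<le> ys ! k" using k by (intro mono) auto
      then show "i \<in> {i. i < n \<and> d \<le> \<bar>ys ! i - c\<bar>}" using i 2 between k by auto
    qed
    then have "card {..k} \<le> card {i. i < n \<and> d \<le> \<bar>ys ! i - c\<bar>}"
      by (intro card_mono) auto
    then show ?thesis using k by simp
  qed
  then show ?thesis by (simp add: len n_def)
qed

text \<open>The sum for \<open>t\<close> depends only on the coordinates in
  \<open>I \<times> {t}\<close>, and these blocks are disjoint for different
  \<open>t\<close>.\<close>

lemma indep_vars_Pi_pmf_row_sums:
  fixes K :: "real pmf"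
  assumes "finite I" "finite L"
  shows "prob_space.indep_vars (measure_pmf (Pi_pmf (I \<times> L) d (\<lambda>_. K))) (\<lambda>_. borel)
           (\<lambda>t \<pi>. \<Sum>s\<in>I. \<pi> (s, t)) L"
proof -
  let ?M = "Pi_pmf (I \<times> L) d (\<lambda>_. K)"
  let ?N = "\<lambda>t. PiM (I \<times> {t}) (\<lambda>_. count_space UNIV :: real measure)"
  have "prob_space.indep_vars ?M ?N (\<lambda>t \<pi>. restrict (\<lambda>i. \<pi> i) (I \<times> {t})) L"
    by (rule prob_space.indep_vars_restrict[OF measure_pmf.prob_space_axioms indep_vars_Pi_pmf])
       (use assms in \<open>auto simp: disjoint_family_on_def\<close>)
  then have "prob_space.indep_vars ?M (\<lambda>_. borel)
      (\<lambda>t \<pi>. (\<lambda>\<omega>. \<Sum>s\<in>I. \<omega> (s, t)) (restrict (\<lambda>i. \<pi> i) (I \<times> {t}))) L"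
  proof (rule prob_space.indep_vars_compose2[OF measure_pmf.prob_space_axioms])
    fix t
    have "(\<lambda>\<omega>. \<omega> (s, t)) \<in> borel_measurable (?N t)" if "s \<in> I" for s
    proof -
      have "(\<lambda>\<omega>. \<omega> (s, t)) \<in> measurable (?N t) (count_space UNIV)"
        using that by (intro measurable_component_singleton) auto
      then show ?thesis
        by (rule measurable_compose) simp
    qed
    then show "(\<lambda>\<omega>. \<Sum>s\<in>I. \<omega> (s, t)) \<in> borel_measurable (?N t)"
      by (intro borel_measurable_sum)
  qed
  then show ?thesis
    by simp
qed

text \<open>Chebyshev applied to the sum over \<open>s\<close>, whose variance is
  \<open>card I\<close> times that of \<open>K\<close>; the hypothesis on the variance is exactly
  what brings the bound down to \<open>1 / 4\<close>.\<close>

lemma prob_row_mean_deviation_le: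
  fixes K :: "real pmf"
  assumes I: "finite I" "I \<noteq> {}" "finite L" and t: "t \<in> L" and d: "0 < d"
    and sq: "integrable K (\<lambda>r. r\<^sup>2)"
    and var: "4 * measure_pmf.variance K (\<lambda>r. r) \<le> real (card I) * d\<^sup>2"
  shows "measure_pmf.prob (Pi_pmf (I \<times> L) e (\<lambda>_. K))
           {\<pi>. d \<le> \<bar>(\<Sum>s\<in>I. \<pi> (s, t)) / real (card I) - measure_pmf.expectation K (\<lambda>r. r)\<bar>} \<le> 1 / 4"
proof -
  let ?M = "Pi_pmf (I \<times> L) e (\<lambda>_. K)" and ?m = "measure_pmf.expectation K (\<lambda>r. r)"
  let ?f = "\<lambda>\<pi>. \<Sum>s\<in>I. \<pi> (s, t)" and ?n = "real (card I)"
  have n: "0 < ?n" using I by (simp add: card_gt_0_iff)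
  \<comment> \<open>Each coordinate has marginal \<open>K\<close>, which transfers its moments to
    the product space.\<close>
  have K: "K = map_pmf (\<lambda>\<pi>. \<pi> (s, t)) ?M" if "s \<in> I" for s
    using that t I by (subst Pi_pmf_component) auto
  have sqs: "integrable ?M (\<lambda>\<pi>. (\<pi> (s, t))\<^sup>2)" if "s \<in> I" for s
    using sq by (subst (asm) K[OF that]) simp
  have ints: "integrable ?M (\<lambda>\<pi>. \<pi> (s, t))" if "s \<in> I" for s
    using measure_pmf.square_integrable_imp_integrable[OF _ sqs[OF that]] by simp
  have Es: "measure_pmf.expectation ?M (\<lambda>\<pi>. \<pi> (s, t)) = ?m" if "s \<in> I" for s
    by (subst K[OF that]) simp
  have Vs: "measure_pmf.variance ?M (\<lambda>\<pi>. \<pi> (s, t)) = measure_pmf.variance K (\<lambda>r. r)" if "s \<in> I" for s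
    by (subst (2) K[OF that], subst Es[OF that]) simp
  have "prob_space.indep_vars ?M (\<lambda>_. count_space UNIV) (\<lambda>i \<pi>. \<pi> i) ((\<lambda>s. (s, t)) ` I)"
    by (rule prob_space.indep_vars_subset[OF measure_pmf.prob_space_axioms indep_vars_Pi_pmf]) (use I t in auto)
  then have ind: "prob_space.indep_vars ?M (\<lambda>_. borel) (\<lambda>i \<pi>. \<pi> i) ((\<lambda>s. (s, t)) ` I)"
    by (rule prob_space.indep_vars_compose2[OF measure_pmf.prob_space_axioms, where Y = "\<lambda>_ x. x", simplified]) simp
  have sumI: "(\<Sum>i\<in>(\<lambda>s. (s, t)) ` I. g i) = (\<Sum>s\<in>I. g (s, t))" for g :: "_ \<Rightarrow> real"
    by (subst sum.reindex) (auto simp: inj_on_def)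
  have "measure_pmf.variance ?M (\<lambda>\<pi>. \<Sum>i\<in>(\<lambda>s. (s, t)) ` I. \<pi> i)
      = (\<Sum>i\<in>(\<lambda>s. (s, t)) ` I. measure_pmf.variance ?M (\<lambda>\<pi>. \<pi> i))"
    by (rule prob_space.variance_sum_indep[OF measure_pmf.prob_space_axioms _ ind]) (use sqs I in auto)
  then have "measure_pmf.variance ?M ?f = (\<Sum>s\<in>I. measure_pmf.variance ?M (\<lambda>\<pi>. \<pi> (s, t)))"
    by (simp only: sumI)
  then have V: "measure_pmf.variance ?M ?f = ?n * measure_pmf.variance K (\<lambda>r. r)"
    using Vs by simp
  have E: "measure_pmf.expectation ?M ?f = ?n * ?m"
    using ints Es by simp
  have int2: "integrable ?M (\<lambda>\<pi>. (?f \<pi>)\<^sup>2)"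
  proof -
    \<comment> \<open>Mixed products are dominated by sums of squares, so the square of the sum is
      integrable.\<close>
    have prod: "integrable ?M (\<lambda>\<pi>. \<pi> (s, t) * \<pi> (s', t))" if "s \<in> I" "s' \<in> I" for s s'
    proof (rule Bochner_Integration.integrable_bound)
      show "integrable ?M (\<lambda>\<pi>. (\<pi> (s, t))\<^sup>2 + (\<pi> (s', t))\<^sup>2)"
        using sqs that by simp
      have "\<bar>a * b\<bar> \<le> a\<^sup>2 + b\<^sup>2" for a b :: real
        using sum_squares_bound[of "\<bar>a\<bar>" "\<bar>b\<bar>"] abs_ge_zero[of "a * b"]
        unfolding abs_mult power2_abs by linarith
      then show "AE \<pi> in ?M. norm (\<pi> (s, t) * \<pi> (s', t)) \<le> norm ((\<pi> (s, t))\<^sup>2 + (\<pi> (s', t))\<^sup>2)"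
        by simp
    qed simp
    show ?thesis
      using prod by (simp add: power2_eq_square sum_product)
  qed
  \<comment> \<open>Scaling by \<open>?n\<close> turns a deviation of the average into one of the
    sum.\<close>
  have "{\<pi>. d \<le> \<bar>?f \<pi> / ?n - ?m\<bar>} = {\<pi>\<in>space ?M. ?n * d \<le> \<bar>?f \<pi> - measure_pmf.expectation ?M ?f\<bar>}"
  proof -
    have "\<bar>?f \<pi> - ?n * ?m\<bar> = ?n * \<bar>?f \<pi> / ?n - ?m\<bar>" for \<pi>
    proof -
      have "?f \<pi> - ?n * ?m = ?n * (?f \<pi> / ?n - ?m)" using n by (simp add: field_simps)
      then show ?thesis using n by (simp only: abs_mult abs_of_nat)
    qed
    then show ?thesis using n by (simp add: E)
  qed
  also have "measure_pmf.prob ?M \<dots> \<le> measure_pmf.variance ?M ?f / (?n * d)\<^sup>2"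
    by (rule measure_pmf.Chebyshev_inequality[OF _ int2]) (use n d in auto)
  also have "\<dots> = measure_pmf.variance K (\<lambda>r. r) / (?n * d\<^sup>2)"
    unfolding V using n by (simp add: power_mult_distrib power2_eq_square[of "real (card I)"])
  also have "\<dots> \<le> 1 / 4"
    using var n d by (simp add: divide_le_eq)
  finally show ?thesis .
qed

text \<open>A bad median needs at least \<open>T / 2\<close> bad averages, while at most
  \<open>T / 4\<close> are expected. The excess of at least \<open>T / 4\<close> has probability at
  most \<open>exp (- 2 * (T / 4)\<^sup>2 / T)\<close> by Hoeffding.\<close>

lemma prob_median_of_means_deviation_le:
  fixes K :: "real pmf" and S T :: nat
  assumes S: "0 < S" and T: "0 < T" and d: "0 < d"
    and sq: "integrable K (\<lambda>r. r\<^sup>2)"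
    and var: "4 * measure_pmf.variance K (\<lambda>r. r) \<le> real S * d\<^sup>2"
  shows "measure_pmf.prob (Pi_pmf ({1..S} \<times> {1..T}) e (\<lambda>_. K))
           {\<pi>. d \<le> \<bar>median (map (\<lambda>t. (\<Sum>s\<in>{1..S}. \<pi> (s, t)) / real S) [1..<Suc T])
                   - measure_pmf.expectation K (\<lambda>r. r)\<bar>} \<le> exp (- real T / 8)"
proof -
  let ?M = "Pi_pmf ({1..S} \<times> {1..T}) e (\<lambda>_. K)" and ?m = "measure_pmf.expectation K (\<lambda>r. r)"
  define avg where "avg = (\<lambda>t (\<pi> :: nat \<times> nat \<Rightarrow> real). (\<Sum>s\<in>{1..S}. \<pi> (s, t)) / real S)"
  define bad where "bad = (\<lambda>t \<pi>. indicator {\<pi>. d \<le> \<bar>avg t \<pi> - ?m\<bar>} \<pi> :: real)"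
  have ind: "prob_space.indep_vars ?M (\<lambda>_. borel) bad {1..T}"
  proof -
    have "prob_space.indep_vars ?M (\<lambda>_. borel)
        (\<lambda>t \<pi>. (\<lambda>r. indicator {r. d \<le> \<bar>r / real S - ?m\<bar>} r :: real) (\<Sum>s\<in>{1..S}. \<pi> (s, t))) {1..T}"
      by (rule prob_space.indep_vars_compose2[OF measure_pmf.prob_space_axioms indep_vars_Pi_pmf_row_sums]) auto
    then show ?thesis
      by (simp add: bad_def avg_def indicator_def)
  qed
  define E where "E = (\<Sum>t\<in>{1..T}. measure_pmf.expectation ?M (bad t))"
  interpret H: Hoeffding_ineq ?M "{1..T}" bad "\<lambda>_. 0" "\<lambda>_. 1" E
    by unfold_locales (use ind in \<open>auto simp: bad_def E_def indicator_def\<close>)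
  have "measure_pmf.expectation ?M (bad t) \<le> 1 / 4" if "t \<in> {1..T}" for t
    using prob_row_mean_deviation_le[of "{1..S}" "{1..T}" t d K e] that S d sq var
    by (simp add: bad_def avg_def)
  then have E: "E \<le> real T / 4"
    using sum_bounded_above[of "{1..T}" "\<lambda>t. measure_pmf.expectation ?M (bad t)" "1 / 4"]
    by (simp add: E_def)
  \<comment> \<open>The threshold \<open>T / 2\<close> is written as the mean \<open>E\<close> plus
    a slack, the form Hoeffding's inequality takes.\<close>
  have "{\<pi>. d \<le> \<bar>median (map (\<lambda>t. avg t \<pi>) [1..<Suc T]) - ?m\<bar>}
      \<subseteq> {\<pi>\<in>space ?M. E + (real T / 2 - E) \<le> (\<Sum>t\<in>{1..T}. bad t \<pi>)}"
  proof
    fix \<pi> assume "\<pi> \<in> {\<pi>. d \<le> \<bar>median (map (\<lambda>t. avg t \<pi>) [1..<Suc T]) - ?m\<bar>}"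
    then have "T \<le> 2 * length (filter (\<lambda>x. d \<le> \<bar>x - ?m\<bar>) (map (\<lambda>t. avg t \<pi>) [1..<Suc T]))"
      using median_deviation[of "map (\<lambda>t. avg t \<pi>) [1..<Suc T]" d ?m] T by simp
    also have "length (filter (\<lambda>x. d \<le> \<bar>x - ?m\<bar>) (map (\<lambda>t. avg t \<pi>) [1..<Suc T]))
        = card (set (filter (\<lambda>t. d \<le> \<bar>avg t \<pi> - ?m\<bar>) [1..<Suc T]))"
      by (subst distinct_card) (auto simp: filter_map o_def)
    also have "set (filter (\<lambda>t. d \<le> \<bar>avg t \<pi> - ?m\<bar>) [1..<Suc T]) = {t\<in>{1..T}. d \<le> \<bar>avg t \<pi> - ?m\<bar>}"
      by auto
    finally have "real T \<le> 2 * real (card {t\<in>{1..T}. d \<le> \<bar>avg t \<pi> - ?m\<bar>})"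
      by linarith
    also have "real (card {t\<in>{1..T}. d \<le> \<bar>avg t \<pi> - ?m\<bar>}) = (\<Sum>t\<in>{1..T}. bad t \<pi>)"
      by (simp add: bad_def indicator_def sum.If_cases Int_def)
    finally show "\<pi> \<in> {\<pi>\<in>space ?M. E + (real T / 2 - E) \<le> (\<Sum>t\<in>{1..T}. bad t \<pi>)}"
      by simp
  qed
  then have "measure_pmf.prob ?M {\<pi>. d \<le> \<bar>median (map (\<lambda>t. avg t \<pi>) [1..<Suc T]) - ?m\<bar>}
      \<le> measure_pmf.prob ?M {\<pi>\<in>space ?M. E + (real T / 2 - E) \<le> (\<Sum>t\<in>{1..T}. bad t \<pi>)}"
    by (intro measure_pmf.finite_measure_mono) auto
  also have "\<dots> \<le> exp (- 2 * (real T / 2 - E)\<^sup>2 / (\<Sum>t\<in>{1..T}. (1 - 0)\<^sup>2))"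
    by (rule H.Hoeffding_ineq_ge) (use E T in auto)
  also have "\<dots> \<le> exp (- real T / 8)"
  proof -
    have "(real T / 4)\<^sup>2 \<le> (real T / 2 - E)\<^sup>2"
      using E by (intro power_mono) auto
    then have "real T * real T \<le> 16 * (real T / 2 - E)\<^sup>2"
      by (simp add: power2_eq_square)
    then show ?thesis using T by (simp add: field_simps)
  qed
  finally show ?thesis by (simp add: avg_def)
qed

text \<open>Median of means with deviation \<open>\<xi> * p\<close>: the choice of \<open>S\<close>
  matches the variance bound of one trial, and the choice of \<open>T\<close> makes the Hoeffding
  bound at most \<open>\<delta>\<close>.\<close>

lemma klm_estimator_approximation:
  assumes card: "1 < card J"
    and P: "\<And>j. j \<in> J \<Longrightarrow> P j = measure_pmf.prob A (Z j)"
    and pos: "\<And>j. j \<in> J \<Longrightarrow> 0 < P j"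
    and \<xi>: "0 < \<xi>" and \<delta>: "0 < \<delta>" "\<delta> < 1"
  shows "is_approximation \<xi> \<delta> (klm_estimator A J Z P \<xi> \<delta>) (measure_pmf.prob A (\<Union>j\<in>J. Z j))"
proof -
  have fin: "finite J" and ne: "J \<noteq> {}" using card by (auto intro: card_ge_0_finite)
  define p where "p = measure_pmf.prob A (\<Union>j\<in>J. Z j)"
  define S where "S = nat \<lceil>4 * (real (card J) - 1) / \<xi>\<^sup>2\<rceil>"
  define T where "T = nat \<lceil>12 * ln (1 / \<delta>)\<rceil>"
  let ?K = "klm_trial A J Z P"
  have E: "measure_pmf.expectation ?K (\<lambda>r. r) = p"
    unfolding p_def by (rule expectation_klm_trial[OF fin ne P pos])
  have bounds: "0 \<le> r" "r \<le> (\<Sum>j\<in>J. P j)" if "r \<in> set_pmf ?K" for r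
    using klm_trial_bounds[OF fin less_imp_le that] pos by auto
  obtain j where j: "j \<in> J" using ne by blast
  have "P j \<le> p"
    unfolding p_def using j P by (auto intro!: measure_pmf.finite_measure_mono)
  then have p: "0 < p" using pos[OF j] by simp
  \<comment> \<open>At least two clauses give at least one sample per average; likewise
    \<open>\<delta> < 1\<close> below gives at least one average.\<close>
  have q: "0 < 4 * (real (card J) - 1) / \<xi>\<^sup>2" using card \<xi> by simp
  then have S: "0 < S" "4 * (real (card J) - 1) / \<xi>\<^sup>2 \<le> real S"
    unfolding S_def by linarith+
  have l: "0 < ln (1 / \<delta>)" using \<delta> by (simp add: ln_div)
  then have T: "0 < T" "12 * ln (1 / \<delta>) \<le> real T"
    unfolding T_def by linarith+
  have sq: "integrable ?K (\<lambda>r. r\<^sup>2)"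
  proof (rule measure_pmf.integrable_const_bound[where B = "(\<Sum>j\<in>J. P j)\<^sup>2"])
    show "AE r in ?K. norm (r\<^sup>2) \<le> (\<Sum>j\<in>J. P j)\<^sup>2"
      using bounds by (auto simp: AE_measure_pmf_iff intro: power_mono)
  qed simp
  have "4 * measure_pmf.variance ?K (\<lambda>r. r) \<le> 4 * (real (card J) - 1) * p\<^sup>2"
    using variance_klm_trial_le[of J P A Z, OF fin ne P pos, folded p_def] by (simp add: algebra_simps)
  also have "\<dots> \<le> real S * \<xi>\<^sup>2 * p\<^sup>2"
    using S(2) \<xi> by (intro mult_right_mono) (auto simp: divide_le_eq)
  finally have var: "4 * measure_pmf.variance ?K (\<lambda>r. r) \<le> real S * (\<xi> * p)\<^sup>2"
    by (simp add: power_mult_distrib mult.assoc)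
  have "measure_pmf.prob (klm_estimator A J Z P \<xi> \<delta>) {x. \<bar>x - p\<bar> \<ge> \<xi> * p} \<le> exp (- real T / 8)"
    using prob_median_of_means_deviation_le[OF S(1) T(1) _ sq var, of 0] mult_pos_pos[OF \<xi> p]
    unfolding klm_estimator_def Let_def S_def[symmetric] T_def[symmetric]
    by (simp only: E measure_map_pmf vimage_def mem_Collect_eq)
  \<comment> \<open>Since \<open>12 \<ge> 8\<close>, \<open>T / 8\<close> is at least
    \<open>ln (1 / \<delta>)\<close>.\<close>
  also have "\<dots> \<le> exp (- ln (1 / \<delta>))"
    using T l by simp
  also have "\<dots> = \<delta>"
    using \<delta> by (simp add: ln_div)
  finally show ?thesis
    by (simp add: is_approximation_def p_def)
qed

section \<open>Cutsets and failure frequency\<close>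

lemma finite_comps [simp]: "finite (comps \<Psi>)"
  by (simp add: comps_def)

lemma finite_subset_comps: "D \<subseteq> comps \<Psi> \<Longrightarrow> finite D"
  by (erule finite_subset) (rule finite_comps)

lemma failed_states_subset: "D \<in> failed_states \<Psi> \<Longrightarrow> D \<subseteq> comps \<Psi>"
  by (simp add: failed_states_def)

lemma finite_failed_states [simp]: "finite (failed_states \<Psi>)"
  by (rule finite_subset[of _ "Pow (comps \<Psi>)"]) (auto simp: failed_states_def)

lemma failed_states_mono:
  assumes D: "D \<in> failed_states \<Psi>" and sub: "D \<subseteq> D'" "D' \<subseteq> comps \<Psi>"
  shows "D' \<in> failed_states \<Psi>"
proof -
  have "adjacency \<Psi> (comps \<Psi> - D') \<subseteq> adjacency \<Psi> (comps \<Psi> - D)"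
    using sub by (auto simp: adjacency_def)
  then have "(adjacency \<Psi> (comps \<Psi> - D'))\<^sup>* \<subseteq> (adjacency \<Psi> (comps \<Psi> - D))\<^sup>*"
    by (rule rtrancl_mono)
  then show ?thesis
    using D sub by (auto simp: failed_states_def connects_terminals_def)
qed

text \<open>A minimal failed subset exists by finiteness; the converse is monotonicity. This
  translates unions of clauses into failure of the system.\<close>

lemma failed_states_iff_cutset:
  assumes "D \<subseteq> comps \<Psi>"
  shows "D \<in> failed_states \<Psi> \<longleftrightarrow> (\<exists>C\<in>cutsets \<Psi>. C \<subseteq> D)"
proof
  assume "D \<in> failed_states \<Psi>"
  then obtain C where C: "C \<in> failed_states \<Psi>" "C \<subseteq> D"
      and min: "\<And>B. B \<in> failed_states \<Psi> \<Longrightarrow> B \<subseteq> C \<Longrightarrow> C = B"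
    using finite_has_minimal2[OF finite_failed_states] by metis
  then show "\<exists>C\<in>cutsets \<Psi>. C \<subseteq> D"
    by (intro bexI[of _ C]) (auto simp: cutsets_def)
next
  assume "\<exists>C\<in>cutsets \<Psi>. C \<subseteq> D"
  then show "D \<in> failed_states \<Psi>"
    using assms failed_states_mono by (auto simp: cutsets_def)
qed

lemma cutsets_subset_failed_states: "cutsets \<Psi> \<subseteq> failed_states \<Psi>"
  by (auto simp: cutsets_def)

lemma cutsets_antichain:
  assumes "C \<in> cutsets \<Psi>" "C' \<in> cutsets \<Psi>" "C \<subseteq> C'"
  shows "C = C'"
  using assms by (auto simp: cutsets_def)

text \<open>Since cutsets form an antichain, having two of them makes each one nonempty and proper; the latter
  gives \<open>P\<^sub>Z(j) > 0\<close>, so that conditioning on \<open>Z\<^sub>j\<close> is meaningful.\<close>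

locale repairable_system =
  fixes \<Psi> :: "'v rel_system"
  assumes fail_pos: "i \<in> comps \<Psi> \<Longrightarrow> 0 < fail_rate \<Psi> i"
    and repair_pos: "i \<in> comps \<Psi> \<Longrightarrow> 0 < repair_rate \<Psi> i"
    and cutsets_card: "1 < card (cutsets \<Psi>)"
begin

lemma cutset_other:
  obtains C' where "C' \<in> cutsets \<Psi>" "C' \<noteq> C"
proof -
  have "\<not> cutsets \<Psi> \<subseteq> {C}"
    using cutsets_card card_mono[of "{C}" "cutsets \<Psi>"] by auto
  then show ?thesis using that by blast
qed

lemma cutset_subset: "C \<in> cutsets \<Psi> \<Longrightarrow> C \<subset> comps \<Psi>"
  using cutset_other[of C] cutsets_antichain[of _ \<Psi> C] cutsets_subset_failed_states[of \<Psi>] failed_states_subset[of _ \<Psi>]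
  by (metis psubsetI subsetD)

lemma cutset_nonempty: "C \<in> cutsets \<Psi> \<Longrightarrow> C \<noteq> {}"
  using cutset_other[of C] cutsets_antichain[of C \<Psi>] by (metis empty_subsetI)

lemma comps_nonempty: "comps \<Psi> \<noteq> {}"
  using cutset_other cutset_subset by blast

lemma unavail_pos: "i \<in> comps \<Psi> \<Longrightarrow> 0 < unavail \<Psi> i"
  using fail_pos[of i] repair_pos[of i] by (simp add: unavail_def)

lemma unavail_less_1: "i \<in> comps \<Psi> \<Longrightarrow> unavail \<Psi> i < 1"
  using fail_pos[of i] repair_pos[of i] by (simp add: unavail_def)

lemma repair_total_pos: "0 < repair_total \<Psi>"
  unfolding repair_total_def using comps_nonempty repair_pos by (intro sum_pos) auto

lemma state_prob_pos: "D \<subseteq> comps \<Psi> \<Longrightarrow> 0 < state_prob \<Psi> D"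
  unfolding state_prob_def using unavail_pos unavail_less_1
  by (intro mult_pos_pos prod_pos) auto

section \<open>Distributions of the state and the exposed component\<close>

text \<open>The sampling variables recoded as the set of true indices, to match
  \<open>failed_states\<close> and \<open>state_prob\<close>.\<close>

definition state_pmf :: "nat set pmf" where
  "state_pmf = map_pmf Collect (Pi_pmf (comps \<Psi>) False (\<lambda>i. bernoulli_pmf (unavail \<Psi> i)))"

definition exposure_pmf :: "nat pmf" where
  "exposure_pmf = weighted_pmf (comps \<Psi>) (repair_rate \<Psi>)"

lemma pmf_state_pmf: "pmf state_pmf D = (if D \<subseteq> comps \<Psi> then state_prob \<Psi> D else 0)"
proof -
  have "pmf state_pmf D = pmf state_pmf (Collect (\<lambda>i. i \<in> D))" by simp
  also have "\<dots> = pmf (Pi_pmf (comps \<Psi>) False (\<lambda>i. bernoulli_pmf (unavail \<Psi> i))) (\<lambda>i. i \<in> D)"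
    unfolding state_pmf_def by (rule pmf_map_inj') (auto simp: inj_def)
  also have "\<dots> = (if D \<subseteq> comps \<Psi> then
      \<Prod>i\<in>comps \<Psi>. if i \<in> D then unavail \<Psi> i else 1 - unavail \<Psi> i else 0)"
    using unavail_pos unavail_less_1
    by (subst pmf_Pi) (auto intro!: prod.cong simp: less_imp_le)
  also have "\<dots> = (if D \<subseteq> comps \<Psi> then state_prob \<Psi> D else 0)"
    by (auto simp: prod.If_cases state_prob_def Int_absorb1 Diff_eq)
  finally show ?thesis .
qed

lemma set_state_pmf: "set_pmf state_pmf \<subseteq> Pow (comps \<Psi>)"
  by (auto simp: set_pmf_iff pmf_state_pmf split: if_splits)

lemma pmf_exposure_pmf:
  "pmf exposure_pmf i = (if i \<in> comps \<Psi> then repair_rate \<Psi> i / repair_total \<Psi> else 0)"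
  unfolding exposure_pmf_def repair_total_def
  using repair_pos repair_total_pos
  by (intro pmf_weighted_pmf) (auto simp: less_imp_le repair_total_def)

lemma assignment_eq:
  "assignment \<Psi> = map_pmf (\<lambda>(D, e). ((\<lambda>i. i \<in> D), (\<lambda>i. i \<noteq> e))) (pair_pmf state_pmf exposure_pmf)"
  by (simp add: assignment_def state_pmf_def exposure_pmf_def pair_pmf_def map_pmf_def
      bind_assoc_pmf bind_return_pmf)

lemma prob_assignment:
  "measure_pmf.prob (assignment \<Psi>) E =
     measure_pmf.prob (pair_pmf state_pmf exposure_pmf) {(D, e). ((\<lambda>i. i \<in> D), (\<lambda>i. i \<noteq> e)) \<in> E}"
  by (simp add: assignment_eq vimage_def case_prod_unfold)

lemma prob_state_superset:
  assumes "C \<subseteq> comps \<Psi>"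
  shows "measure_pmf.prob state_pmf {D. C \<subseteq> D} = prob_X \<Psi> C"
proof -
  \<comment> \<open>The event is a box: coordinates in \<open>C\<close> are forced, the others are
    free and contribute a factor 1.\<close>
  let ?B = "\<lambda>i. if i \<in> C then {True} else UNIV"
  have "measure_pmf.prob state_pmf {D. C \<subseteq> D}
      = measure_pmf.prob (Pi_pmf (comps \<Psi>) False (\<lambda>i. bernoulli_pmf (unavail \<Psi> i))) (Pi (comps \<Psi>) ?B)"
    unfolding state_pmf_def measure_map_pmf
    using assms by (intro arg_cong2[where f = measure]) (auto simp: Pi_iff split: if_splits)
  also have "\<dots> = (\<Prod>i\<in>comps \<Psi>. measure_pmf.prob (bernoulli_pmf (unavail \<Psi> i)) (?B i))"
    by (rule measure_Pi_pmf_Pi) simp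
  also have "\<dots> = (\<Prod>i\<in>comps \<Psi>. if i \<in> C then unavail \<Psi> i else 1)"
    using unavail_pos unavail_less_1
    by (intro prod.cong) (auto simp: measure_pmf_single less_imp_le)
  also have "\<dots> = prob_X \<Psi> C"
    using assms by (simp add: prod.If_cases prob_X_def Int_absorb1)
  finally show ?thesis .
qed

lemma prob_exposure_notin:
  assumes "C \<subseteq> comps \<Psi>"
  shows "measure_pmf.prob exposure_pmf (- C) = 1 - (\<Sum>i\<in>C. repair_rate \<Psi> i / repair_total \<Psi>)"
proof -
  have "finite C" using assms finite_subset_comps by blast
  then have "measure_pmf.prob exposure_pmf C = (\<Sum>i\<in>C. repair_rate \<Psi> i / repair_total \<Psi>)"
    using assms by (subst measure_measure_pmf_finite) (auto simp: pmf_exposure_pmf intro!: sum.cong)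
  then show ?thesis
    using measure_pmf.prob_compl[of C exposure_pmf] by (simp add: Compl_eq_Diff_UNIV)
qed

lemma prob_clause_X:
  assumes "C \<subseteq> comps \<Psi>"
  shows "measure_pmf.prob (assignment \<Psi>) (clause_X C) = prob_X \<Psi> C"
proof -
  have "measure_pmf.prob (assignment \<Psi>) (clause_X C)
      = measure_pmf.prob (map_pmf fst (pair_pmf state_pmf exposure_pmf)) {D. C \<subseteq> D}"
    unfolding prob_assignment measure_map_pmf
    by (intro arg_cong2[where f = measure]) (auto simp: clause_X_def)
  then show ?thesis
    using assms by (simp add: map_fst_pair_pmf prob_state_superset del: measure_map_pmf)
qed

lemma prob_clause_Z:
  assumes "C \<subseteq> comps \<Psi>"
  shows "measure_pmf.prob (assignment \<Psi>) (clause_Z C) = prob_Z \<Psi> C"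
proof -
  \<comment> \<open>Cutting down to subsets of \<open>comps \<Psi>\<close> loses no probability and
    makes the set finite, as the product rule requires countable factors.\<close>
  let ?S = "{D. C \<subseteq> D} \<inter> Pow (comps \<Psi>)"
  have "measure_pmf.prob (assignment \<Psi>) (clause_Z C)
      = measure_pmf.prob (pair_pmf state_pmf exposure_pmf) (?S \<times> - C)"
    unfolding prob_assignment
    by (rule measure_pmf.finite_measure_eq_AE)
       (use set_state_pmf in \<open>auto simp: AE_measure_pmf_iff clause_Z_def clause_X_def clause_Y_def\<close>)
  also have "\<dots> = measure_pmf.prob state_pmf ?S * measure_pmf.prob exposure_pmf (- C)"
    by (rule measure_pmf_prob_product) (auto intro: countable_finite)
  also have "measure_pmf.prob state_pmf ?S = measure_pmf.prob state_pmf {D. C \<subseteq> D}"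
    by (rule measure_pmf.finite_measure_eq_AE)
       (use set_state_pmf in \<open>auto simp: AE_measure_pmf_iff\<close>)
  finally show ?thesis
    using assms by (simp add: prob_state_superset prob_exposure_notin prob_Z_def)
qed

lemma prob_X_pos: "C \<in> cutsets \<Psi> \<Longrightarrow> 0 < prob_X \<Psi> C"
  unfolding prob_X_def using unavail_pos cutset_subset by (intro prod_pos) auto

lemma prob_Z_pos:
  assumes "C \<in> cutsets \<Psi>"
  shows "0 < prob_Z \<Psi> C"
proof -
  obtain i where "i \<in> comps \<Psi> - C" "C \<subseteq> comps \<Psi>" using cutset_subset[OF assms] by auto
  then have "(\<Sum>i\<in>C. repair_rate \<Psi> i) < repair_total \<Psi>"
    unfolding repair_total_def using repair_pos
    by (intro sum_strict_mono2[where b = i]) (auto simp: less_imp_le)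
  then have "(\<Sum>i\<in>C. repair_rate \<Psi> i / repair_total \<Psi>) < 1"
    using repair_total_pos by (simp flip: sum_divide_distrib)
  then show ?thesis
    using prob_X_pos[OF assms] by (simp add: prob_Z_def)
qed

section \<open>Union probabilities and the failure frequency\<close>

definition system_unavail :: real where
  "system_unavail = measure_pmf.prob (assignment \<Psi>) (\<Union>C\<in>cutsets \<Psi>. clause_X C)"

text \<open>The probability that the system is still failed once the exposed component is counted as
  available.\<close>

definition unexposed_unavail :: real where
  "unexposed_unavail = measure_pmf.prob (assignment \<Psi>) (\<Union>C\<in>cutsets \<Psi>. clause_Z C)"

lemma unexposed_unavail_le: "unexposed_unavail \<le> system_unavail"
  unfolding unexposed_unavail_def system_unavail_def
  by (rule measure_pmf.finite_measure_mono) (auto simp: clause_Z_def)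

lemma system_unavail_eq: "system_unavail = (\<Sum>D\<in>failed_states \<Psi>. state_prob \<Psi> D)"
proof -
  have "system_unavail = measure_pmf.prob (map_pmf fst (pair_pmf state_pmf exposure_pmf)) (failed_states \<Psi>)"
    unfolding system_unavail_def prob_assignment measure_map_pmf
    \<comment> \<open>The two events agree only on states contained in \<open>comps \<Psi>\<close>,
      hence almost everywhere.\<close>
    by (rule measure_pmf.finite_measure_eq_AE)
       (use set_state_pmf in \<open>auto simp: AE_measure_pmf_iff clause_X_def failed_states_iff_cutset subset_eq\<close>)
  also have "\<dots> = (\<Sum>D\<in>failed_states \<Psi>. pmf state_pmf D)"
    by (simp add: map_fst_pair_pmf measure_measure_pmf_finite del: measure_map_pmf)
  also have "\<dots> = (\<Sum>D\<in>failed_states \<Psi>. state_prob \<Psi> D)"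
    by (intro sum.cong) (auto simp: pmf_state_pmf dest: failed_states_subset)
  finally show ?thesis .
qed

text \<open>The difference is the probability that the state is failed and repairing the exposed
  component restores the system. A pair \<open>(D, i)\<close> has probability \<open>state_prob
  \<Psi> D * repair_rate \<Psi> i / repair_total \<Psi>\<close>.\<close>

lemma unavail_diff_eq:
  "(system_unavail - unexposed_unavail) * repair_total \<Psi>
     = (\<Sum>D\<in>failed_states \<Psi>. \<Sum>i\<in>{i\<in>D. D - {i} \<notin> failed_states \<Psi>}. state_prob \<Psi> D * repair_rate \<Psi> i)"
proof -
  let ?M = "pair_pmf state_pmf exposure_pmf"
  let ?F = "{(D, e). D \<in> failed_states \<Psi>}" and ?G = "{(D, e). D - {e} \<in> failed_states \<Psi>}"
  let ?crit = "SIGMA D:failed_states \<Psi>. {i\<in>D. D - {i} \<notin> failed_states \<Psi>}"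
  have X: "system_unavail = measure_pmf.prob ?M ?F"
    unfolding system_unavail_def prob_assignment
    by (rule measure_pmf.finite_measure_eq_AE)
       (use set_state_pmf in \<open>auto simp: AE_measure_pmf_iff clause_X_def failed_states_iff_cutset subset_eq\<close>)
  have Z: "unexposed_unavail = measure_pmf.prob ?M (?F \<inter> ?G)"
    unfolding unexposed_unavail_def prob_assignment
  proof (rule measure_pmf.finite_measure_eq_AE)
    show "AE x in ?M. (x \<in> {(D, e). ((\<lambda>i. i \<in> D), (\<lambda>i. i \<noteq> e)) \<in> (\<Union>C\<in>cutsets \<Psi>. clause_Z C)})
        = (x \<in> ?F \<inter> ?G)"
      unfolding AE_measure_pmf_iff
    proof (rule ballI, clarify)
      fix D e assume "(D, e) \<in> set_pmf ?M"
      then have D: "D \<subseteq> comps \<Psi>" using set_state_pmf by auto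
      have "((\<lambda>i. i \<in> D), (\<lambda>i. i \<noteq> e)) \<in> (\<Union>C\<in>cutsets \<Psi>. clause_Z C)
          \<longleftrightarrow> (\<exists>C\<in>cutsets \<Psi>. C \<subseteq> D - {e})"
        by (auto simp: clause_Z_def clause_X_def clause_Y_def)
      also have "\<dots> \<longleftrightarrow> D - {e} \<in> failed_states \<Psi>"
        using D by (intro failed_states_iff_cutset[symmetric]) auto
      \<comment> \<open>Monotonicity of failure lets \<open>?F\<close> be intersected in, so that
        the difference below becomes a set difference.\<close>
      also have "\<dots> \<longleftrightarrow> D \<in> failed_states \<Psi> \<and> D - {e} \<in> failed_states \<Psi>"
        using D failed_states_mono[of "D - {e}" \<Psi> D] by auto
      finally show "((D, e) \<in> {(D, e). ((\<lambda>i. i \<in> D), (\<lambda>i. i \<noteq> e)) \<in> (\<Union>C\<in>cutsets \<Psi>. clause_Z C)})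
          = ((D, e) \<in> ?F \<inter> ?G)"
        by simp
    qed
  qed auto
  have fin: "finite D" if "D \<in> failed_states \<Psi>" for D
    using failed_states_subset[OF that] by (rule finite_subset_comps)
  have "system_unavail - unexposed_unavail = measure_pmf.prob ?M (?F - (?F \<inter> ?G))"
    unfolding X Z by (subst measure_pmf.finite_measure_Diff) auto
  \<comment> \<open>If \<open>e\<close> were not in \<open>D\<close>, removing it would change
    nothing; so \<open>e \<in> D\<close>.\<close>
  also have "?F - (?F \<inter> ?G) = ?crit"
  proof -
    have "e \<in> D" if "D \<in> failed_states \<Psi>" "D - {e} \<notin> failed_states \<Psi>" for D e
      using that by (cases "e \<in> D") auto
    then show ?thesis by auto
  qed
  also have "measure_pmf.prob ?M ?crit = (\<Sum>x\<in>?crit. pmf ?M x)"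
    using fin by (intro measure_measure_pmf_finite finite_SigmaI) auto
  also have "\<dots> = (\<Sum>(D, i)\<in>?crit. state_prob \<Psi> D * (repair_rate \<Psi> i / repair_total \<Psi>))"
    using failed_states_subset[of _ \<Psi>, THEN subsetD]
    by (intro sum.cong) (auto simp: failed_states_subset pmf_pair pmf_state_pmf pmf_exposure_pmf)
  also have "\<dots> = (\<Sum>D\<in>failed_states \<Psi>. \<Sum>i\<in>{i\<in>D. D - {i} \<notin> failed_states \<Psi>}.
      state_prob \<Psi> D * (repair_rate \<Psi> i / repair_total \<Psi>))"
    using fin by (intro sum.Sigma[symmetric]) auto
  finally show ?thesis
    using repair_total_pos by (simp add: sum_distrib_right)
qed

text \<open>The two states differ only in the factor of component \<open>i\<close>, where \<open>(1
  - unavail \<Psi> i) * fail_rate \<Psi> i = unavail \<Psi> i * repair_rate \<Psi>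
  i\<close>.\<close>

lemma state_prob_balance:
  assumes "i \<in> D" "D \<subseteq> comps \<Psi>"
  shows "state_prob \<Psi> (D - {i}) * fail_rate \<Psi> i = state_prob \<Psi> D * repair_rate \<Psi> i"
proof -
  have fin: "finite D" using assms finite_subset_comps by blast
  have i: "i \<in> comps \<Psi>" using assms by auto
  have c: "comps \<Psi> - (D - {i}) = insert i (comps \<Psi> - D)" using assms by auto
  have "(1 - unavail \<Psi> i) * fail_rate \<Psi> i = unavail \<Psi> i * repair_rate \<Psi> i"
    using fail_pos[OF i] repair_pos[OF i] by (simp add: unavail_def field_simps)
  moreover have "state_prob \<Psi> (D - {i}) =
      (\<Prod>j\<in>D - {i}. unavail \<Psi> j) * (\<Prod>j\<in>comps \<Psi> - D. 1 - unavail \<Psi> j) * (1 - unavail \<Psi> i)"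
    using assms by (simp add: state_prob_def c)
  moreover have "state_prob \<Psi> D =
      (\<Prod>j\<in>D - {i}. unavail \<Psi> j) * (\<Prod>j\<in>comps \<Psi> - D. 1 - unavail \<Psi> j) * unavail \<Psi> i"
    using prod.remove[OF fin assms(1), of "unavail \<Psi>"] by (simp add: state_prob_def)
  ultimately show ?thesis by (simp add: mult.assoc)
qed

text \<open>By balance, failures out of failed states cancel the repairs that lead from one failed
  state to another; only repairs that restore the system remain.\<close>

lemma failure_frequency_eq:
  "failure_frequency \<Psi> = (system_unavail - unexposed_unavail) * repair_total \<Psi>"
proof -
  let ?S = "failed_states \<Psi>"
  let ?g = "\<lambda>D i. state_prob \<Psi> D * repair_rate \<Psi> i"
  have fin: "finite D" if "D \<in> ?S" for D
    using failed_states_subset[OF that] by (rule finite_subset_comps)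
  have "(\<Sum>D\<in>?S. \<Sum>i\<in>comps \<Psi> - D. state_prob \<Psi> D * fail_rate \<Psi> i)
      = (\<Sum>(D, i)\<in>(SIGMA D:?S. comps \<Psi> - D). state_prob \<Psi> D * fail_rate \<Psi> i)"
    by (rule sum.Sigma) auto
  also have "\<dots> = (\<Sum>(D, i)\<in>(SIGMA D:?S. {i\<in>D. D - {i} \<in> ?S}). ?g D i)"
  \<comment> \<open>Each failure transition is paired with its reverse repair; monotonicity keeps
    \<open>insert i D\<close> failed.\<close>
  proof (rule sum.reindex_bij_witness[where j = "\<lambda>(D, i). (insert i D, i)" and i = "\<lambda>(D, i). (D - {i}, i)"])
    fix a assume "a \<in> (SIGMA D:?S. comps \<Psi> - D)"
    then obtain D i where a: "a = (D, i)" "D \<in> ?S" "i \<in> comps \<Psi>" "i \<notin> D" by auto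
    have sub: "insert i D \<subseteq> comps \<Psi>" using a failed_states_subset by auto
    then have ins: "insert i D \<in> ?S" using a failed_states_mono by blast
    show "(case case a of (D, i) \<Rightarrow> (insert i D, i) of (D, i) \<Rightarrow> (D - {i}, i)) = a"
      using a by auto
    show "(case a of (D, i) \<Rightarrow> (insert i D, i)) \<in> (SIGMA D:?S. {i\<in>D. D - {i} \<in> ?S})"
      using a ins by auto
    show "(case case a of (D, i) \<Rightarrow> (insert i D, i) of (D, i) \<Rightarrow> ?g D i)
        = (case a of (D, i) \<Rightarrow> state_prob \<Psi> D * fail_rate \<Psi> i)"
      using state_prob_balance[of i "insert i D"] sub a by auto
  qed (auto dest: failed_states_subset)
  also have "\<dots> = (\<Sum>D\<in>?S. \<Sum>i\<in>{i\<in>D. D - {i} \<in> ?S}. ?g D i)"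
    using fin by (intro sum.Sigma[symmetric]) auto
  finally have flow: "(\<Sum>D\<in>?S. \<Sum>i\<in>comps \<Psi> - D. state_prob \<Psi> D * fail_rate \<Psi> i)
      = (\<Sum>D\<in>?S. \<Sum>i\<in>{i\<in>D. D - {i} \<in> ?S}. ?g D i)" .
  have split: "(\<Sum>i\<in>D. ?g D i) = (\<Sum>i\<in>{i\<in>D. D - {i} \<in> ?S}. ?g D i) + (\<Sum>i\<in>{i\<in>D. D - {i} \<notin> ?S}. ?g D i)"
    if "D \<in> ?S" for D
    using fin[OF that] by (subst sum.union_disjoint[symmetric]) (auto intro: sum.cong)
  have "failure_frequency \<Psi> = (\<Sum>D\<in>?S. \<Sum>i\<in>D. ?g D i)
      - (\<Sum>D\<in>?S. \<Sum>i\<in>comps \<Psi> - D. state_prob \<Psi> D * fail_rate \<Psi> i)"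
    by (simp add: failure_frequency_def right_diff_distrib sum_subtractf sum_distrib_left)
  also have "\<dots> = (\<Sum>D\<in>?S. \<Sum>i\<in>{i\<in>D. D - {i} \<notin> ?S}. ?g D i)"
    using split by (simp add: flow sum.distrib)
  also have "\<dots> = (system_unavail - unexposed_unavail) * repair_total \<Psi>"
    by (rule unavail_diff_eq[symmetric])
  finally show ?thesis .
qed

text \<open>Every failed state contains a cutset, so at least \<open>min_cut_size \<Psi>\<close>
  components are under repair and at most the remaining ones can fail; thus
  \<open>rho \<Psi>\<close> bounds the bracket of each term from below.\<close>

lemma rho_mult_system_unavail_le: "rho \<Psi> * system_unavail \<le> failure_frequency \<Psi>"
proof -
  have "state_prob \<Psi> D * rho \<Psi> \<le> state_prob \<Psi> D *
      ((\<Sum>i\<in>D. repair_rate \<Psi> i) - (\<Sum>i\<in>comps \<Psi> - D. fail_rate \<Psi> i))"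
    if D: "D \<in> failed_states \<Psi>" for D
  proof (rule mult_left_mono)
    have sub: "D \<subseteq> comps \<Psi>" using D by (rule failed_states_subset)
    have fin: "finite D" using sub by (rule finite_subset_comps)
    obtain C where C: "C \<in> cutsets \<Psi>" "C \<subseteq> D" using D sub failed_states_iff_cutset by blast
    have "min_cut_size \<Psi> \<le> card C"
      unfolding min_cut_size_def using C finite_subset[OF cutsets_subset_failed_states[of \<Psi>]] by (intro Min_le) auto
    also have "\<dots> \<le> card D" using C fin by (intro card_mono)
    finally have s: "min_cut_size \<Psi> \<le> card D" .
    have rm: "repair_min \<Psi> \<le> repair_rate \<Psi> i" and fm: "fail_rate \<Psi> i \<le> fail_max \<Psi>" if "i \<in> comps \<Psi>" for i
      using that by (auto simp: repair_min_def fail_max_def)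
    have pos: "0 < repair_min \<Psi>"
      unfolding repair_min_def using comps_nonempty repair_pos by (subst Min_gr_iff) auto
    obtain i where i: "i \<in> comps \<Psi>" using comps_nonempty by auto
    have fpos: "0 < fail_max \<Psi>" using fm[OF i] fail_pos[OF i] by simp
    have "repair_min \<Psi> * real (min_cut_size \<Psi>) \<le> repair_min \<Psi> * real (card D)"
      using s pos by simp
    also have "\<dots> \<le> (\<Sum>i\<in>D. repair_rate \<Psi> i)"
      using sum_bounded_below[of D "repair_min \<Psi>" "repair_rate \<Psi>"] rm sub by (auto simp: mult.commute)
    finally have 1: "repair_min \<Psi> * real (min_cut_size \<Psi>) \<le> (\<Sum>i\<in>D. repair_rate \<Psi> i)" .
    have "(\<Sum>i\<in>comps \<Psi> - D. fail_rate \<Psi> i) \<le> real (card (comps \<Psi> - D)) * fail_max \<Psi>"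
      using fm by (intro sum_bounded_above) auto
    also have "card (comps \<Psi> - D) = ncomps \<Psi> - card D"
      using sub fin by (simp add: card_Diff_subset comps_def)
    also have "real (ncomps \<Psi> - card D) = real (ncomps \<Psi>) - real (card D)"
      using sub card_mono[of "comps \<Psi>" D] by (simp add: comps_def of_nat_diff)
    also have "(real (ncomps \<Psi>) - real (card D)) * fail_max \<Psi>
        \<le> (real (ncomps \<Psi>) - real (min_cut_size \<Psi>)) * fail_max \<Psi>"
      using s fpos by simp
    finally show "rho \<Psi> \<le> (\<Sum>i\<in>D. repair_rate \<Psi> i) - (\<Sum>i\<in>comps \<Psi> - D. fail_rate \<Psi> i)"
      using 1 by (simp add: rho_def mult.commute)
    show "0 \<le> state_prob \<Psi> D" using state_prob_pos[OF sub] by simp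
  qed
  then have "(\<Sum>D\<in>failed_states \<Psi>. state_prob \<Psi> D * rho \<Psi>) \<le> failure_frequency \<Psi>"
    unfolding failure_frequency_def by (rule sum_mono)
  then show ?thesis
    by (simp add: system_unavail_eq mult.commute sum_distrib_left)
qed

text \<open>The formula for \<open>rho \<Psi>\<close> increases with the cut size, which is at least
  1 because cutsets are nonempty; at size 1 its positivity is the assumption on the rates.\<close>

lemma rho_pos:
  assumes "repair_min \<Psi> / fail_max \<Psi> > real (ncomps \<Psi>) - 1"
  shows "0 < rho \<Psi>"
proof -
  have pos: "0 < repair_min \<Psi>"
    unfolding repair_min_def using comps_nonempty repair_pos by (subst Min_gr_iff) auto
  have fpos: "0 < fail_max \<Psi>"
    unfolding fail_max_def using comps_nonempty fail_pos by (subst Max_gr_iff) auto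
  have ne: "cutsets \<Psi> \<noteq> {}" "finite (cutsets \<Psi>)"
    using cutsets_card by (auto intro: card_ge_0_finite)
  have "1 \<le> card C" if "C \<in> cutsets \<Psi>" for C
    using cutset_nonempty[OF that] cutset_subset[OF that] finite_subset[of C "comps \<Psi>"]
    by (auto simp: Suc_le_eq card_gt_0_iff)
  then have s: "1 \<le> real (min_cut_size \<Psi>)"
    unfolding min_cut_size_def using ne by simp
  have "0 < repair_min \<Psi> * 1 - fail_max \<Psi> * (real (ncomps \<Psi>) - 1)"
    using assms fpos by (simp add: field_simps)
  also have "\<dots> \<le> rho \<Psi>"
    unfolding rho_def using s pos fpos by (intro diff_mono mult_left_mono) auto
  finally show ?thesis .
qed

end

section \<open>Error propagation to the final output\<close>

text \<open>Union bound: the combined output can be off only if one of the two inputs is.\<close>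

lemma is_approximation_pair:
  assumes X: "is_approximation \<xi> \<delta>\<^sub>1 X x" and Y: "is_approximation \<xi> \<delta>\<^sub>2 Y y"
    and imp: "\<And>a b. \<bar>a - x\<bar> < \<xi> * x \<Longrightarrow> \<bar>b - y\<bar> < \<xi> * y \<Longrightarrow> \<bar>f a b - z\<bar> < \<epsilon> * z"
  shows "is_approximation \<epsilon> (\<delta>\<^sub>1 + \<delta>\<^sub>2) (X \<bind> (\<lambda>a. Y \<bind> (\<lambda>b. return_pmf (f a b)))) z"
proof -
  let ?M = "pair_pmf X Y" and ?A = "{a. \<xi> * x \<le> \<bar>a - x\<bar>}" and ?B = "{b. \<xi> * y \<le> \<bar>b - y\<bar>}"
  have "X \<bind> (\<lambda>a. Y \<bind> (\<lambda>b. return_pmf (f a b))) = map_pmf (\<lambda>(a, b). f a b) ?M"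
    by (simp add: pair_pmf_def map_pmf_def bind_assoc_pmf bind_return_pmf)
  then have "measure_pmf.prob (X \<bind> (\<lambda>a. Y \<bind> (\<lambda>b. return_pmf (f a b)))) {w. \<epsilon> * z \<le> \<bar>w - z\<bar>}
      = measure_pmf.prob ?M ((\<lambda>(a, b). f a b) -` {w. \<epsilon> * z \<le> \<bar>w - z\<bar>})"
    by simp
  also have "\<dots> \<le> measure_pmf.prob ?M (fst -` ?A \<union> snd -` ?B)"
    using imp by (intro measure_pmf.finite_measure_mono) (auto simp: not_le[symmetric], blast)
  also have "\<dots> \<le> measure_pmf.prob ?M (fst -` ?A) + measure_pmf.prob ?M (snd -` ?B)"
    by (rule measure_Un_le) auto
  also have "\<dots> = measure_pmf.prob X ?A + measure_pmf.prob Y ?B"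
    by (simp only: measure_map_pmf[symmetric] map_fst_pair_pmf map_snd_pair_pmf)
  also have "\<dots> \<le> \<delta>\<^sub>1 + \<delta>\<^sub>2"
    using X Y by (simp add: is_approximation_def)
  finally show ?thesis by (simp add: is_approximation_def)
qed

theorem theorem1:
  fixes \<Psi> :: "'v rel_system" and \<epsilon> \<delta> :: real
  assumes "k_terminal_system \<Psi>"
    and "repair_min \<Psi> / fail_max \<Psi> > real (ncomps \<Psi>) - 1"
    and "card (cutsets \<Psi>) > 1"
    and "\<epsilon> > 0" and "0 < \<delta>" and "\<delta> < 1"
  shows "is_approximation \<epsilon> \<delta> (algorithm_A \<Psi> \<epsilon> \<delta>) (failure_frequency \<Psi>)"
proof -
  interpret repairable_system \<Psi>
    using assms by unfold_locales (auto simp: k_terminal_system_def)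
  define \<xi> where "\<xi> = (\<epsilon> / 2) * (rho \<Psi> / repair_total \<Psi>)"
  have \<xi>: "0 < \<xi>"
    using rho_pos[OF assms(2)] repair_total_pos assms(4) by (simp add: \<xi>_def)
  have subset: "C \<subseteq> comps \<Psi>" if "C \<in> cutsets \<Psi>" for C
    using cutset_subset[OF that] by auto
  have approx_Z: "is_approximation \<xi> (\<delta> / 2)
      (klm_estimator (assignment \<Psi>) (cutsets \<Psi>) clause_Z (prob_Z \<Psi>) \<xi> (\<delta> / 2)) unexposed_unavail"
    unfolding unexposed_unavail_def
    by (rule klm_estimator_approximation[OF assms(3)])
       (use \<xi> assms subset in \<open>auto simp: prob_clause_Z prob_Z_pos\<close>)
  have approx_X: "is_approximation \<xi> (\<delta> / 2)
      (klm_estimator (assignment \<Psi>) (cutsets \<Psi>) clause_X (prob_X \<Psi>) \<xi> (\<delta> / 2)) system_unavail"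
    unfolding system_unavail_def
    by (rule klm_estimator_approximation[OF assms(3)])
       (use \<xi> assms subset in \<open>auto simp: prob_clause_X prob_X_pos\<close>)
  have "is_approximation \<epsilon> (\<delta> / 2 + \<delta> / 2) (algorithm_A \<Psi> \<epsilon> \<delta>) (failure_frequency \<Psi>)"
    unfolding algorithm_A_def Let_def \<xi>_def[symmetric]
  proof (rule is_approximation_pair[OF approx_Z approx_X])
    fix P P\<^sub>f
    assume Z: "\<bar>P - unexposed_unavail\<bar> < \<xi> * unexposed_unavail"
      and X: "\<bar>P\<^sub>f - system_unavail\<bar> < \<xi> * system_unavail"
    have "\<xi> * unexposed_unavail \<le> \<xi> * system_unavail"
      using unexposed_unavail_le \<xi> by simp
    \<comment> \<open>Both absolute errors are measured against the larger probability
      \<open>system_unavail\<close>.\<close>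
    then have "\<bar>(P\<^sub>f - P) - (system_unavail - unexposed_unavail)\<bar> < 2 * \<xi> * system_unavail"
      using X Z by linarith
    then have "\<bar>(P\<^sub>f - P) - (system_unavail - unexposed_unavail)\<bar> * repair_total \<Psi>
        < 2 * \<xi> * system_unavail * repair_total \<Psi>"
      using repair_total_pos by simp
    \<comment> \<open>The choice of \<open>\<xi>\<close> absorbs the factor 2 and
      \<open>repair_total \<Psi>\<close>.\<close>
    also have "\<dots> = \<epsilon> * (rho \<Psi> * system_unavail)"
      using repair_total_pos by (simp add: \<xi>_def)
    also have "\<dots> \<le> \<epsilon> * failure_frequency \<Psi>"
      using rho_mult_system_unavail_le assms(4) by simp
    finally have "\<bar>(P\<^sub>f - P) - (system_unavail - unexposed_unavail)\<bar> * repair_total \<Psi>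
        < \<epsilon> * failure_frequency \<Psi>" .
    moreover have "(P\<^sub>f - P) * repair_total \<Psi> - failure_frequency \<Psi>
        = ((P\<^sub>f - P) - (system_unavail - unexposed_unavail)) * repair_total \<Psi>"
      by (simp add: failure_frequency_eq algebra_simps)
    ultimately show "\<bar>(P\<^sub>f - P) * repair_total \<Psi> - failure_frequency \<Psi>\<bar> < \<epsilon> * failure_frequency \<Psi>"
      using repair_total_pos by (simp add: abs_mult)
  qed
  then show ?thesis by simp
qed

end
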